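(* Let $A$ and $E$ be real symmetric $n\times n$ matrices with $E\neq0$, $\tilde A=A+E$, and let $1\le p\le n-1$. Put $\delta_p=\lambda_p-\lambda_{p+1}$ and, for $K>0$, let $r_{p,K}$ be the number of eigenvalues of $A$ (with multiplicity) that are at least $\lambda_p-\frac{\delta_p}{2}-K\|E\|$. Assume that for some parameter $K>0$, $$\delta_p\ \ge\ 90\log\!\left(3+\frac{\sigma_1}{\sqrt{r_{p,K}\,x\,\|E\|}}\right)\cdot\max\left\{\frac{\|E\|}{K},\ \sqrt{r_{p,K}\,x\,\|E\|}\right\}.$$ Then $$\tilde\lambda_p\ \ge\ \lambda_p-45\log\!\left(3+\frac{\sigma_1}{\sqrt{r_{p,K}\,x\,\|E\|}}\right)\cdot\max\left\{\frac{\|E\|}{K},\ \sqrt{r_{p,K}\,x\,\|E\|}\right\}.$$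
   Context: $\|\cdot\|$ is the spectral norm; $\log$ is natural. $\lambda_1\ge\dots\ge\lambda_n$ are the eigenvalues of $A$, $\tilde\lambda_1\ge\dots\ge\tilde\lambda_n$ those of $\tilde A$, and $\sigma_1=\|A\|$. Fix an orthonormal eigenbasis $u_1,\dots,u_n$ of $A$ (any choice is allowed when eigenvalues are multiple) and put $x:=\max_{1\le i,j\le n}|u_i^\top E u_j|$. *)

theory Defs
  imports "HOL-Analysis.Analysis" "HOL-Computational_Algebra.Computational_Algebra"
begin

text \<open>
  The spectral norm is the operator norm for the Euclidean norm; the type class norm on
  \<^typ>\<open>real ^ 'n ^ 'n\<close> is the Frobenius norm instead.
\<close>

definition spectral_norm :: "real ^ 'n ^ 'n \<Rightarrow> real" where
  "spectral_norm A = onorm (\<lambda>v. A *v v)"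

definition charpoly :: "real ^ 'n ^ 'n \<Rightarrow> real poly" where
  "charpoly A = det (\<chi> i j. (if i = j then [:0, 1:] else 0) - [:A $ i $ j:])"

lemma poly_charpoly: "poly (charpoly A) t = det (mat t - A)"
proof -
  have "poly (prod f S) t = prod (\<lambda>i. poly (f i) t) S" for f :: "'a \<Rightarrow> real poly" and S
    by (simp add: poly_prod)
  moreover have "poly (of_int k) t = of_int k" for k :: int
    by (simp add: of_int_poly)
  ultimately show ?thesis
    unfolding charpoly_def det_def mat_def
    by (auto simp: poly_sum intro!: sum.cong prod.cong)
qed

text \<open>
  Real eigenvalues repeated according to their algebraic multiplicity, in decreasing order. The
  list has length \<open>CARD('n)\<close> when the matrix is symmetric, since the characteristic polynomial
  then splits over the reals.
\<close>

definition eigenvalues :: "real ^ 'n ^ 'n \<Rightarrow> real list" where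
  "eigenvalues A = rev (sorted_list_of_multiset (proots (charpoly A)))"

text \<open>The \<open>k\<close>-th largest eigenvalue, counted from \<open>k = 1\<close>.\<close>

definition eigval :: "real ^ 'n ^ 'n \<Rightarrow> nat \<Rightarrow> real" where
  "eigval A k = eigenvalues A ! (k - 1)"

definition eigen_gap :: "real ^ 'n ^ 'n \<Rightarrow> nat \<Rightarrow> real" where
  "eigen_gap A p = eigval A p - eigval A (p + 1)"

definition eigen_count :: "real ^ 'n ^ 'n \<Rightarrow> real ^ 'n ^ 'n \<Rightarrow> nat \<Rightarrow> real \<Rightarrow> nat" where
  "eigen_count A E p K =
     length (filter (\<lambda>\<mu>. \<mu> \<ge> eigval A p - eigen_gap A p / 2 - K * spectral_norm E)
       (eigenvalues A))"

text \<open>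
  The basis is indexed by the coordinate type rather than by \<open>1, \<dots>, n\<close>, so its members need not
  be listed in the order of the eigenvalues; \<open>max_interaction\<close> does not depend on the order.
  An orthonormal family of \<open>CARD('n)\<close> vectors is automatically a basis.
\<close>

definition orthonormal_eigenbasis :: "real ^ 'n ^ 'n \<Rightarrow> ('n \<Rightarrow> real ^ 'n) \<Rightarrow> bool" where
  "orthonormal_eigenbasis A u \<longleftrightarrow>
     (\<forall>i j. u i \<bullet> u j = (if i = j then 1 else 0)) \<and>
     (\<forall>i. \<exists>\<mu>. A *v u i = \<mu> *\<^sub>R u i)"

definition max_interaction :: "('n::finite \<Rightarrow> real ^ 'n) \<Rightarrow> real ^ 'n ^ 'n \<Rightarrow> real" where
  "max_interaction u E = Max {\<bar>u i \<bullet> (E *v u j)\<bar> | i j. True}"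

end

theory Submission
  imports Defs
begin

text \<open>
  The number \<open>r\<close> of counted eigenvalues is at least \<open>p\<close>. The quadratic form of \<open>E\<close> at a unit
  vector in the span of \<open>p\<close> leading eigenvectors of \<open>A\<close> is at most \<open>p x \<le> r x\<close> in absolute value
  (Cauchy-Schwarz on the coefficients), and it is also at most \<open>\<parallel>E\<parallel>\<close>, so it is at most the
  geometric mean \<open>sqrt (r x \<parallel>E\<parallel>)\<close>. On this span the form of \<open>A\<close> is at least \<open>\<lambda>\<^sub>p\<close>, so the
  Courant-Fischer principle gives \<open>\<lambda>\<^sub>p - sqrt (r x \<parallel>E\<parallel>)\<close> as a lower bound for the \<open>p\<close>-th
  eigenvalue of \<open>A + E\<close>. The logarithm is at least \<open>1\<close> because \<open>3 > e\<close>.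
\<close>

section \<open>Order statistics of a decreasing list as counts\<close>

lemma le_nth_iff_le_length_filter:
  fixes xs :: "'a::linorder list"
  assumes "sorted_wrt (\<ge>) xs" "1 \<le> p" "p \<le> length xs"
  shows "t \<le> xs ! (p - 1) \<longleftrightarrow> p \<le> length (filter (\<lambda>y. t \<le> y) xs)"
  using assms
proof (induction xs arbitrary: p)
  case (Cons y ys)
  show ?case
  proof (cases "t \<le> y")
    case True
    show ?thesis
    \<comment> \<open>Positions are counted from 1, so the induction hypothesis at
      \<open>p - 1\<close> is available only when \<open>p\<close> is at least 2.\<close>
    proof (cases "p = 1")
      case False
      then show ?thesis
        using Cons.IH[of "p - 1"] Cons.prems True by (auto simp: nth_Cons')
    qed (use True in auto)
  next
    case False
    \<comment> \<open>The head is the largest entry, so if it fails to reach \<open>t\<close> all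
      entries fail and both sides of the equivalence are false.\<close>
    then have below: "\<not> t \<le> z" if "z \<in> set (y # ys)" for z
      using that Cons.prems(1) by force
    have "(y # ys) ! (p - 1) \<in> set (y # ys)"
      using Cons.prems by (intro nth_mem) auto
    moreover have "filter ((\<le>) t) (y # ys) = []"
      using below by (simp add: filter_empty_conv)
    ultimately show ?thesis
      using below Cons.prems(2) by fastforce
  qed
qed simp

section \<open>Orthonormal families and their spans\<close>

lemma orthonormal_span_card:
  fixes u :: "'i \<Rightarrow> 'a::euclidean_space"
  assumes on: "\<And>i j. u i \<bullet> u j = (if i = j then 1 else 0)"
  shows "dim (span (u ` I)) = card I"
proof -
  have "inj u"
    using on by (intro injI) (metis zero_neq_one)
  moreover have "independent (u ` I)"
  proof (rule pairwise_orthogonal_independent)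
    show "pairwise orthogonal (u ` I)"
      using on by (auto simp: pairwise_def orthogonal_def)
    show "0 \<notin> u ` I"
      using on by (metis image_iff inner_zero_left zero_neq_one)
  qed
  ultimately show ?thesis
    by (simp add: dim_eq_card_independent card_image inj_on_subset)
qed

lemma span_image_eq_sum:
  fixes u :: "'i::finite \<Rightarrow> 'a::real_vector"
  assumes "v \<in> span (u ` I)"
  obtains c where "v = (\<Sum>i\<in>I. c i *\<^sub>R u i)"
proof -
  have "\<exists>c. v = (\<Sum>i\<in>I. c i *\<^sub>R u i)"
    using assms
  proof (induction rule: span_induct_alt)
    case base
    show ?case by (intro exI[of _ "\<lambda>_. 0"]) simp
  next
    case (step a w z)
    then obtain i c where "i \<in> I" "w = u i" "z = (\<Sum>i\<in>I. c i *\<^sub>R u i)"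
      by blast
    then have "a *\<^sub>R w + z = (\<Sum>j\<in>I. ((if j = i then a else 0) + c j) *\<^sub>R u j)"
      by (simp add: scaleR_add_left sum.distrib if_distrib[of "\<lambda>r. r *\<^sub>R _"] cong: if_cong)
    then show ?case by (intro exI[of _ "\<lambda>j. (if j = i then a else 0) + c j"])
  qed
  then show ?thesis using that by blast
qed

lemma inner_sum_orthonormal:
  fixes u :: "'i::finite \<Rightarrow> 'a::real_inner"
  assumes "\<And>i j. u i \<bullet> u j = (if i = j then 1 else 0)"
  shows "(\<Sum>i\<in>I. a i *\<^sub>R u i) \<bullet> (\<Sum>i\<in>I. b i *\<^sub>R u i) = (\<Sum>i\<in>I. a i * b i)"
proof -
  have "(\<Sum>i\<in>I. a i *\<^sub>R u i) \<bullet> (\<Sum>j\<in>I. b j *\<^sub>R u j) =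
      (\<Sum>i\<in>I. \<Sum>j\<in>I. if i = j then a i * b j else 0)"
    unfolding inner_sum_left inner_sum_right by (intro sum.cong refl) (simp add: assms)
  then show ?thesis by simp
qed

section \<open>Spectral theorem for real symmetric matrices\<close>

lemma symmetric_inner_matrix:
  fixes B :: "real ^ 'n ^ 'n"
  assumes "transpose B = B"
  shows "x \<bullet> (B *v y) = (B *v x) \<bullet> y"
  using assms by (metis dot_lmul_matrix transpose_matrix_vector)

text \<open>The Rayleigh quotient attains its maximum on the compact unit sphere of
  \<open>W\<close>, and a maximiser is an eigenvector. Invariance of \<open>W\<close> keeps the
  residual \<open>B *v v - \<mu> *\<^sub>R v\<close> inside \<open>W\<close>, so it is an admissible
  direction of variation.\<close>

lemma symmetric_eigenvector_in_subspace:
  fixes B :: "real ^ 'n ^ 'n"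
  assumes sym: "transpose B = B" and W: "subspace W"
    and inv: "\<And>w. w \<in> W \<Longrightarrow> B *v w \<in> W" and nontriv: "\<exists>w\<in>W. w \<noteq> 0"
  obtains v \<mu> where "v \<in> W" "norm v = 1" "B *v v = \<mu> *\<^sub>R v"
proof -
  let ?S = "sphere 0 1 \<inter> W"
  obtain w0 where "w0 \<in> W" "w0 \<noteq> 0" using nontriv by blast
  then have "w0 /\<^sub>R norm w0 \<in> ?S"
    using W by (simp add: subspace_scale)
  moreover have "compact ?S"
    using W by (intro compact_Int_closed compact_sphere closed_subspace)
  moreover have "continuous_on ?S (\<lambda>v. v \<bullet> (B *v v))"
    by (intro continuous_intros linear_continuous_on matrix_vector_mul_bounded_linear)
  ultimately obtain v where v: "v \<in> ?S" and max: "\<And>w. w \<in> ?S \<Longrightarrow> w \<bullet> (B *v w) \<le> v \<bullet> (B *v v)"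
    using continuous_attains_sup[of ?S "\<lambda>v. v \<bullet> (B *v v)"] by blast
  define \<mu> where "\<mu> = v \<bullet> (B *v v)"
  have vW: "v \<in> W" and nv: "norm v = 1" using v by auto
  \<comment> \<open>By homogeneity the maximality extends from the sphere to all of
    \<open>W\<close>, so vectors \<open>v + s *\<^sub>R w\<close> can be tested without normalising
    them.\<close>
  have le: "w \<bullet> (B *v w) \<le> \<mu> * (norm w)\<^sup>2" if "w \<in> W" for w
  proof (cases "w = 0")
    case False
    then have "w /\<^sub>R norm w \<in> ?S"
      using that W by (simp add: subspace_scale)
    then have "(w /\<^sub>R norm w) \<bullet> (B *v (w /\<^sub>R norm w)) \<le> \<mu>"
      unfolding \<mu>_def by (rule max)
    then show ?thesis
      using False by (simp add: matrix_vector_mult_scaleR power2_eq_square field_simps)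
  qed simp
  define w where "w = B *v v - \<mu> *\<^sub>R v"
  have wW: "w \<in> W"
    unfolding w_def using W inv vW by (simp add: subspace_diff subspace_scale)
  have vv: "v \<bullet> v = 1" using nv by (simp add: dot_square_norm)
  have "v \<bullet> w = 0"
    by (simp add: w_def inner_diff_right vv \<mu>_def)
  then have wv: "w \<bullet> v = 0" by (simp add: inner_commute)
  have ww: "w \<bullet> (B *v v) = w \<bullet> w"
  proof -
    have "w \<bullet> w = w \<bullet> (B *v v) - \<mu> * (w \<bullet> v)"
      by (subst (2) w_def) (simp add: inner_diff_right)
    then show ?thesis using wv by simp
  qed
  have ww': "v \<bullet> (B *v w) = w \<bullet> w"
    using symmetric_inner_matrix[OF sym, of v w] ww by (simp add: inner_commute)
  define C where "C = \<mu> * (w \<bullet> w) - w \<bullet> (B *v w)"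
  \<comment> \<open>Second-order expansion of the Rayleigh quotient at its maximum, in the direction \<open>w\<close>.\<close>
  have quad: "2 * s * (w \<bullet> w) \<le> s\<^sup>2 * C" for s
  proof -
    have "(v + s *\<^sub>R w) \<bullet> (B *v (v + s *\<^sub>R w)) \<le> \<mu> * (norm (v + s *\<^sub>R w))\<^sup>2"
      using W vW wW by (intro le subspace_add subspace_scale)
    then have "\<mu> + 2 * s * (w \<bullet> w) + s\<^sup>2 * (w \<bullet> (B *v w)) \<le> \<mu> * (1 + s\<^sup>2 * (w \<bullet> w))"
      using ww ww' wv vv unfolding power2_norm_eq_inner
      by (simp add: matrix_vector_right_distrib matrix_vector_mult_scaleR inner_add_left
          inner_add_right inner_commute[of v w] \<mu>_def[symmetric] power2_eq_square algebra_simps)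
    then show ?thesis
      by (simp add: C_def algebra_simps)
  qed
  have "w \<bullet> w \<le> 0"
  proof (rule ccontr)
    assume "\<not> w \<bullet> w \<le> 0"
    then obtain a where a: "w \<bullet> w = a" "a > 0" by (meson not_le)
    then have C: "C > 0" using quad[of 1] by simp
    show False
      \<comment> \<open>For small \<open>s\<close> the linear gain beats the quadratic term. Any
        \<open>s\<close> strictly between 0 and \<open>2 * a / C\<close> contradicts
        \<open>quad\<close>; the midpoint is taken.\<close>
      using quad[of "a / C"] C \<open>a > 0\<close> unfolding a(1) by (simp add: power2_eq_square field_simps)
  qed
  then have "w = 0" using inner_ge_zero[of w] by (metis inner_eq_zero_iff order_antisym)
  then have "B *v v = \<mu> *\<^sub>R v" by (simp add: w_def)
  then show ?thesis using that vW nv by blast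
qed

text \<open>Induction over the index set: the vectors orthogonal to the eigenvectors found so far
  form a subspace, which is invariant by symmetry and therefore contains a further unit
  eigenvector.\<close>

theorem symmetric_orthonormal_eigenbasis:
  fixes B :: "real ^ 'n ^ 'n"
  assumes sym: "transpose B = B"
  obtains w where "orthonormal_eigenbasis B w"
proof -
  have "\<exists>w :: 'n \<Rightarrow> real ^ 'n. (\<forall>i\<in>I. \<forall>j\<in>I. w i \<bullet> w j = (if i = j then 1 else 0)) \<and>
          (\<forall>i\<in>I. \<exists>\<mu>. B *v w i = \<mu> *\<^sub>R w i)" for I :: "'n set"
    using finite[of I]
  proof (induction I rule: finite_induct)
    case (insert k I)
    then obtain w :: "'n \<Rightarrow> real ^ 'n"
      where on: "\<And>i j. i \<in> I \<Longrightarrow> j \<in> I \<Longrightarrow> w i \<bullet> w j = (if i = j then 1 else 0)"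
        and eig: "\<And>i. i \<in> I \<Longrightarrow> \<exists>\<mu>. B *v w i = \<mu> *\<^sub>R w i"
      by blast
    define W where "W = {v. \<forall>i\<in>I. w i \<bullet> v = 0}"
    have W: "subspace W"
      unfolding W_def by (auto simp: subspace_def inner_add_right)
    have inv: "B *v v \<in> W" if "v \<in> W" for v
    proof -
      have "w i \<bullet> (B *v v) = 0" if "i \<in> I" for i
      proof -
        obtain \<mu> where "B *v w i = \<mu> *\<^sub>R w i" using eig[OF \<open>i \<in> I\<close>] by blast
        then have "w i \<bullet> (B *v v) = \<mu> * (w i \<bullet> v)"
          by (simp only: symmetric_inner_matrix[OF sym] inner_scaleR_left)
        then show ?thesis using \<open>v \<in> W\<close> that by (simp add: W_def)
      qed
      then show ?thesis by (simp add: W_def)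
    qed
    \<comment> \<open>Fewer than \<open>CARD('n)\<close> vectors cannot span the space, so
      \<open>W\<close> contains a nonzero vector.\<close>
    have "dim (w ` I) \<le> card I"
      using dim_le_card'[of "w ` I"] card_image_le[of I w] by simp
    also have "\<dots> < DIM(real ^ 'n)"
      using insert.hyps(2) psubset_card_mono[of UNIV I] by auto
    finally obtain z where "z \<noteq> 0" "\<And>y. y \<in> span (w ` I) \<Longrightarrow> orthogonal z y"
      using orthogonal_to_subspace_exists[of "w ` I"] by metis
    then have "z \<in> W"
      by (simp add: W_def span_base orthogonal_def inner_commute[of _ z])
    then obtain v \<mu> where v: "v \<in> W" "norm v = 1" "B *v v = \<mu> *\<^sub>R v"
      using symmetric_eigenvector_in_subspace[OF sym W inv] \<open>z \<noteq> 0\<close> by blast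
    then have "v \<bullet> v = 1" "\<And>i. i \<in> I \<Longrightarrow> w i \<bullet> v = 0 \<and> v \<bullet> w i = 0"
      by (auto simp: dot_square_norm W_def inner_commute)
    then show ?case
      using on eig v(3) insert.hyps(2)
      by (intro exI[of _ "w(k := v)"] conjI ballI) (auto simp: fun_upd_def split: if_splits)
  qed simp
  from this[of UNIV] show ?thesis
    using that unfolding orthonormal_eigenbasis_def by auto
qed

section \<open>From an eigenbasis to the ordered list of eigenvalues\<close>

lemma charpoly_orthonormal_eigenvectors:
  fixes B :: "real ^ 'n ^ 'n" and w :: "'n \<Rightarrow> real ^ 'n"
  assumes on: "\<And>i j. w i \<bullet> w j = (if i = j then 1 else 0)"
    and eig: "\<And>i. B *v w i = \<nu> i *\<^sub>R w i"
  shows "charpoly B = (\<Prod>i\<in>UNIV. [:- \<nu> i, 1:])"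
proof -
  define U :: "real ^ 'n ^ 'n" where "U = (\<chi> i. w i)"
  have colU: "column j (transpose U) = w j" for j
    by (simp add: U_def column_transpose row_def vec_eq_iff)
  \<comment> \<open>Change of basis, used twice: \<open>M = mat 1\<close> shows that
    \<open>U\<close> is orthogonal, and \<open>M = mat t - B\<close> gives a diagonal
    matrix.\<close>
  have ent: "(U ** M ** transpose U) $ i $ j = w i \<bullet> (M *v w j)" for M i j
  proof -
    have "(U ** (M ** transpose U)) $ i $ j = row i U \<bullet> column j (M ** transpose U)"
      by (simp add: matrix_mult_dot row_def column_def inner_vec_def matrix_matrix_mult_def)
    also have "column j (M ** transpose U) = M *v w j"
      by (simp add: U_def column_def transpose_def matrix_matrix_mult_def matrix_vector_mult_def)
    finally show ?thesis by (simp add: U_def row_def matrix_mul_assoc)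
  qed
  have "(U ** transpose U) $ i $ j = mat 1 $ i $ j" for i j
    using ent[of "mat 1" i j] by (simp add: on) (simp add: mat_def)
  then have "U ** transpose U = mat 1"
    by (simp add: vec_eq_iff)
  then have det1: "det U * det (transpose U) = 1"
    by (metis det_I det_mul)
  \<comment> \<open>Real polynomials are determined by their values, so it is enough to compute
    determinants of real matrices at each \<open>t\<close>.\<close>
  have "poly (charpoly B) t = poly (\<Prod>i\<in>UNIV. [:- \<nu> i, 1:]) t" for t
  proof -
    have M: "(mat t - B) *v w j = (t - \<nu> j) *\<^sub>R w j" for j
    proof -
      have "mat t *v w j = t *\<^sub>R w j"
        by (simp add: vec_eq_iff matrix_vector_mult_def mat_def if_distrib[of "\<lambda>r. r * _"] cong: if_cong)
      then show ?thesis
        by (simp add: matrix_vector_mult_diff_rdistrib eig scaleR_diff_left)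
    qed
    have "det (mat t - B) = det (U ** (mat t - B) ** transpose U)"
      using det1 by (simp add: det_mul)
    also have "\<dots> = (\<Prod>i\<in>UNIV. t - \<nu> i)"
      by (subst det_diagonal) (simp_all add: ent M on)
    finally show ?thesis by (simp add: poly_charpoly poly_prod)
  qed
  then show ?thesis
    by (simp add: poly_eq_poly_eq_iff[symmetric] fun_eq_iff)
qed

lemma sorted_wrt_eigenvalues: "sorted_wrt (\<ge>) (eigenvalues A)"
  by (simp add: eigenvalues_def sorted_wrt_rev)

text \<open>Each basis index contributes one linear factor to the characteristic polynomial, hence
  one root counted with multiplicity.\<close>

lemma mset_eigenvalues:
  fixes B :: "real ^ 'n ^ 'n" and w :: "'n \<Rightarrow> real ^ 'n"
  assumes "\<And>i j. w i \<bullet> w j = (if i = j then 1 else 0)"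
    and "\<And>i. B *v w i = \<nu> i *\<^sub>R w i"
  shows "mset (eigenvalues B) = image_mset \<nu> (mset_set UNIV)"
proof -
  have "(\<Sum>i\<in>I. {#\<nu> i#}) = image_mset \<nu> (mset_set I)" for I
    using finite[of I] by (induction I rule: finite_induct) auto
  then show ?thesis
    by (simp add: eigenvalues_def charpoly_orthonormal_eigenvectors[OF assms] proots_prod)
qed

lemma length_filter_eigenvalues:
  fixes B :: "real ^ 'n ^ 'n" and w :: "'n \<Rightarrow> real ^ 'n"
  assumes "\<And>i j. w i \<bullet> w j = (if i = j then 1 else 0)"
    and "\<And>i. B *v w i = \<nu> i *\<^sub>R w i"
  shows "length (filter P (eigenvalues B)) = card {i. P (\<nu> i)}"
proof -
  have "length (filter P (eigenvalues B)) = size (filter_mset P (mset (eigenvalues B)))"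
    by (metis mset_filter size_mset)
  also have "\<dots> = card {i. P (\<nu> i)}"
    by (simp add: mset_eigenvalues[OF assms] filter_mset_image_mset filter_mset_mset_set)
  finally show ?thesis .
qed

text \<open>This replaces the sorted list by a count over the indices of any eigenbasis, whatever
  its order. Taking \<open>t = eigval B p\<close> produces at least \<open>p\<close> indices whose
  eigenvalue reaches the \<open>p\<close>-th one.\<close>

lemma le_eigval_iff:
  fixes B :: "real ^ 'n ^ 'n" and w :: "'n \<Rightarrow> real ^ 'n"
  assumes "\<And>i j. w i \<bullet> w j = (if i = j then 1 else 0)"
    and "\<And>i. B *v w i = \<nu> i *\<^sub>R w i"
    and "1 \<le> p" "p \<le> CARD('n)"
  shows "t \<le> eigval B p \<longleftrightarrow> p \<le> card {i. t \<le> \<nu> i}"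
proof -
  have "length (eigenvalues B) = CARD('n)"
    using length_filter_eigenvalues[OF assms(1,2), of "\<lambda>_. True"] by simp
  then show ?thesis
    using le_nth_iff_le_length_filter[OF sorted_wrt_eigenvalues, of p B t] assms(3,4)
    by (simp add: eigval_def length_filter_eigenvalues[OF assms(1,2)])
qed

section \<open>Courant-Fischer lower bound\<close>

lemma inner_matrix_eigenvector_sum:
  fixes B :: "real ^ 'n ^ 'n" and w :: "'n \<Rightarrow> real ^ 'n"
  assumes "\<And>i j. w i \<bullet> w j = (if i = j then 1 else 0)"
    and "\<And>i. B *v w i = \<nu> i *\<^sub>R w i"
  shows "(\<Sum>i\<in>I. c i *\<^sub>R w i) \<bullet> (B *v (\<Sum>i\<in>I. c i *\<^sub>R w i)) = (\<Sum>i\<in>I. \<nu> i * (c i)\<^sup>2)"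
proof -
  have "B *v (\<Sum>i\<in>I. c i *\<^sub>R w i) = (\<Sum>i\<in>I. (c i * \<nu> i) *\<^sub>R w i)"
    by (simp add: linear_sum[OF matrix_vector_mul_linear] matrix_vector_mult_scaleR assms(2))
  then show ?thesis
    by (simp add: inner_sum_orthonormal[OF assms(1)] power2_eq_square mult_ac)
qed

text \<open>If fewer than \<open>p\<close> eigenvalues reached \<open>t\<close>, the eigenvectors
  with eigenvalue below \<open>t\<close> would span more than \<open>CARD('n) - p\<close>
  dimensions. This span would share a nonzero vector with \<open>S\<close>, at which the form is
  both at least and strictly below \<open>t\<close> times the squared norm.\<close>

theorem eigval_ge_of_subspace:
  fixes B :: "real ^ 'n ^ 'n"
  assumes sym: "transpose B = B" and S: "subspace S" and dimS: "p \<le> dim S" and "1 \<le> p"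
    and quad: "\<And>v. v \<in> S \<Longrightarrow> t * (v \<bullet> v) \<le> v \<bullet> (B *v v)"
  shows "t \<le> eigval B p"
proof -
  obtain w where "orthonormal_eigenbasis B w"
    using symmetric_orthonormal_eigenbasis[OF sym] .
  then obtain \<nu> where on: "\<And>i j. w i \<bullet> w j = (if i = j then 1 else 0)"
    and eig: "\<And>i. B *v w i = \<nu> i *\<^sub>R w i"
    unfolding orthonormal_eigenbasis_def by metis
  have "p \<le> CARD('n)"
    using dimS dim_subset_UNIV[of S] by simp
  have "p \<le> card {i. t \<le> \<nu> i}"
  proof (rule ccontr)
    assume less: "\<not> p \<le> card {i. t \<le> \<nu> i}"
    define J where "J = {i. \<nu> i < t}"
    have "J = UNIV - {i. t \<le> \<nu> i}" by (auto simp: J_def)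
    then have "card J = CARD('n) - card {i. t \<le> \<nu> i}"
      by (simp add: card_Diff_subset)
    then have gt: "CARD('n) < dim S + dim (span (w ` J))"
      using less dimS card_mono[of UNIV "{i. t \<le> \<nu> i}"]
      unfolding orthonormal_span_card[OF on] by simp
    \<comment> \<open>The sum of the two subspaces fits into the whole space, so by the dimension
      formula the excess in \<open>gt\<close> must lie in their intersection.\<close>
    have "dim {x + y |x y. x \<in> S \<and> y \<in> span (w ` J)} \<le> CARD('n)"
      using dim_subset_UNIV[of "{x + y |x y. x \<in> S \<and> y \<in> span (w ` J)}"] by simp
    then have "dim (S \<inter> span (w ` J)) > 0"
      using dim_sums_Int[OF S subspace_span, of "w ` J"] gt by linarith
    then obtain v where v: "v \<in> S" "v \<in> span (w ` J)" "v \<noteq> 0"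
      by (metis Int_iff bot_nat_0.not_eq_extremum dim_eq_0 singletonI subsetI)
    obtain c where c: "v = (\<Sum>i\<in>J. c i *\<^sub>R w i)"
      using span_image_eq_sum[OF v(2)] .
    have "t * (\<Sum>i\<in>J. (c i)\<^sup>2) \<le> (\<Sum>i\<in>J. \<nu> i * (c i)\<^sup>2)"
      using quad[OF v(1)] unfolding c inner_matrix_eigenvector_sum[OF on eig]
      by (simp add: inner_sum_orthonormal[OF on] power2_eq_square)
    \<comment> \<open>Strictness needs one nonzero coefficient, which exists because
      \<open>v\<close> is nonzero.\<close>
    moreover have "(\<Sum>i\<in>J. \<nu> i * (c i)\<^sup>2) < (\<Sum>i\<in>J. t * (c i)\<^sup>2)"
    proof (rule sum_strict_mono_ex1)
      show "\<exists>i\<in>J. \<nu> i * (c i)\<^sup>2 < t * (c i)\<^sup>2"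
      proof (rule ccontr)
        assume "\<not> ?thesis"
        then have "c i = 0" if "i \<in> J" for i
          using that by (force simp: J_def not_less mult_le_cancel_right)
        then show False using v(3) c by simp
      qed
    qed (auto simp: J_def intro!: mult_right_mono)
    ultimately show False by (simp add: sum_distrib_left)
  qed
  then show ?thesis
    using le_eigval_iff[OF on eig] \<open>1 \<le> p\<close> \<open>p \<le> CARD('n)\<close> by blast
qed

section \<open>Two bounds on the quadratic form of the perturbation\<close>

lemma max_interaction_bound: "\<bar>u i \<bullet> (E *v u j)\<bar> \<le> max_interaction u E"
proof -
  have "{\<bar>u i \<bullet> (E *v u j)\<bar> |i j. True} = (\<lambda>(i, j). \<bar>u i \<bullet> (E *v u j)\<bar>) ` UNIV"
    by auto
  then have "finite {\<bar>u i \<bullet> (E *v u j)\<bar> |i j. True}" by simp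
  then show ?thesis
    unfolding max_interaction_def by (rule Max_ge) blast
qed

text \<open>Bounding every entry of the double sum by the maximum leaves the square of the l1 norm
  of \<open>c\<close>; Cauchy-Schwarz trades it for the squared l2 norm at the cost of the factor
  \<open>card I\<close>.\<close>

lemma inner_matrix_sum_bound:
  fixes E :: "real ^ 'n ^ 'n" and u :: "'n \<Rightarrow> real ^ 'n"
  assumes on: "\<And>i j. u i \<bullet> u j = (if i = j then 1 else 0)"
    and v: "v = (\<Sum>i\<in>I. c i *\<^sub>R u i)"
  shows "\<bar>v \<bullet> (E *v v)\<bar> \<le> card I * max_interaction u E * (v \<bullet> v)"
proof -
  let ?x = "max_interaction u E"
  have x0: "0 \<le> ?x"
    by (rule order_trans[OF abs_ge_zero max_interaction_bound])
  have "v \<bullet> (E *v v) = (\<Sum>i\<in>I. \<Sum>j\<in>I. c i * c j * (u i \<bullet> (E *v u j)))"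
    unfolding v by (subst sum.swap) (simp add: linear_sum[OF matrix_vector_mul_linear] matrix_vector_mult_scaleR inner_sum_left
        inner_sum_right sum_distrib_left mult_ac)
  also have "\<bar>\<dots>\<bar> \<le> (\<Sum>i\<in>I. \<Sum>j\<in>I. \<bar>c i * c j * (u i \<bullet> (E *v u j))\<bar>)"
    by (intro order_trans[OF sum_abs] sum_mono sum_abs)
  also have "\<dots> \<le> (\<Sum>i\<in>I. \<Sum>j\<in>I. \<bar>c i\<bar> * \<bar>c j\<bar> * ?x)"
    unfolding abs_mult by (intro sum_mono mult_left_mono max_interaction_bound) simp
  also have "\<dots> = ?x * (\<Sum>i\<in>I. \<bar>c i\<bar>)\<^sup>2"
    by (simp add: power2_eq_square sum_product sum_distrib_left mult_ac)
  also have "\<dots> \<le> ?x * (card I * (\<Sum>i\<in>I. (c i)\<^sup>2))"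
  proof (rule mult_left_mono[OF _ x0])
    show "(\<Sum>i\<in>I. \<bar>c i\<bar>)\<^sup>2 \<le> card I * (\<Sum>i\<in>I. (c i)\<^sup>2)"
      using sum_squared_le_sum_of_squares[of "\<lambda>i. \<bar>c i\<bar>" I] by (simp add: mult.commute)
  qed
  finally show ?thesis
    by (simp add: v inner_sum_orthonormal[OF on] power2_eq_square mult_ac)
qed

lemma spectral_norm_nonneg: "0 \<le> spectral_norm A"
  unfolding spectral_norm_def by (intro onorm_pos_le matrix_vector_mul_bounded_linear)

lemma inner_matrix_spectral_norm: "\<bar>v \<bullet> (E *v v)\<bar> \<le> spectral_norm E * (v \<bullet> v)"
proof -
  have "\<bar>v \<bullet> (E *v v)\<bar> \<le> norm v * norm (E *v v)"
    by (rule Cauchy_Schwarz_ineq2)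
  also have "\<dots> \<le> norm v * (spectral_norm E * norm v)"
    unfolding spectral_norm_def
    by (intro mult_left_mono onorm matrix_vector_mul_bounded_linear) simp
  finally show ?thesis
    by (simp add: dot_square_norm power2_eq_square mult_ac)
qed

section \<open>Perturbation of the \<open>p\<close>-th eigenvalue\<close>

lemma eigval_perturbation:
  fixes A E :: "real ^ 'n ^ 'n" and r :: nat
  assumes "transpose A = A" "transpose E = E" and p: "1 \<le> p" "p \<le> CARD('n)"
    and "orthonormal_eigenbasis A u" and r: "p \<le> r"
  shows "eigval A p - sqrt (r * max_interaction u E * spectral_norm E) \<le> eigval (A + E) p"
proof -
  let ?x = "max_interaction u E" and ?e = "spectral_norm E" and ?l = "eigval A p"
  obtain \<mu> where on: "\<And>i j. u i \<bullet> u j = (if i = j then 1 else 0)"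
    and eig: "\<And>i. A *v u i = \<mu> i *\<^sub>R u i"
    using assms(5) unfolding orthonormal_eigenbasis_def by metis
  have "p \<le> card {i. ?l \<le> \<mu> i}"
    using le_eigval_iff[OF on eig p, of ?l] by simp
  \<comment> \<open>Ties at \<open>?l\<close> may give more than \<open>p\<close> indices. Keeping
    exactly \<open>p\<close> of them makes the factor \<open>card P\<close> at most
    \<open>r\<close>.\<close>
  then obtain P where P: "P \<subseteq> {i. ?l \<le> \<mu> i}" "card P = p"
    by (metis obtain_subset_with_card_n)
  have x0: "0 \<le> ?x"
    by (rule order_trans[OF abs_ge_zero max_interaction_bound])
  have e0: "0 \<le> ?e" by (rule spectral_norm_nonneg)
  show ?thesis
  proof (rule eigval_ge_of_subspace)
    show "transpose (A + E) = A + E"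
      using assms(1,2) by (simp add: transpose_def vec_eq_iff)
    show "p \<le> dim (span (u ` P))"
      unfolding orthonormal_span_card[OF on] using P by simp
    fix v assume "v \<in> span (u ` P)"
    then obtain c where v: "v = (\<Sum>i\<in>P. c i *\<^sub>R u i)"
      using span_image_eq_sum by blast
    have "?l * (v \<bullet> v) \<le> v \<bullet> (A *v v)"
      unfolding v inner_matrix_eigenvector_sum[OF on eig] inner_sum_orthonormal[OF on]
      using P(1) by (auto simp: sum_distrib_left power2_eq_square intro!: sum_mono mult_right_mono)
    moreover have "\<bar>v \<bullet> (E *v v)\<bar> \<le> sqrt (r * ?x * ?e) * (v \<bullet> v)"
    proof -
      have "\<bar>v \<bullet> (E *v v)\<bar> \<le> p * ?x * (v \<bullet> v)"
        using inner_matrix_sum_bound[OF on v, of E] P(2) by simp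
      also have "\<dots> \<le> r * ?x * (v \<bullet> v)"
        using r x0 by (intro mult_right_mono) auto
      \<comment> \<open>Each factor of the square is bounded by a different estimate, so the root
        yields their geometric mean.\<close>
      finally have "\<bar>v \<bullet> (E *v v)\<bar> * \<bar>v \<bullet> (E *v v)\<bar> \<le> (r * ?x * (v \<bullet> v)) * (?e * (v \<bullet> v))"
        using inner_matrix_spectral_norm[of v E] x0 by (intro mult_mono) auto
      then have "(v \<bullet> (E *v v))\<^sup>2 \<le> (r * ?x * ?e) * (v \<bullet> v)\<^sup>2"
        by (simp add: power2_eq_square mult_ac abs_mult_self_eq)
      then have "\<bar>v \<bullet> (E *v v)\<bar> \<le> sqrt ((r * ?x * ?e) * (v \<bullet> v)\<^sup>2)"
        by (metis real_sqrt_abs real_sqrt_le_iff)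
      then show ?thesis by (simp add: real_sqrt_mult)
    qed
    ultimately show "(?l - sqrt (r * ?x * ?e)) * (v \<bullet> v) \<le> v \<bullet> ((A + E) *v v)"
      by (simp add: matrix_vector_mult_add_rdistrib inner_add_right algebra_simps)
  qed (use p in simp_all)
qed

theorem theorem3p1:
  fixes A E :: "real ^ 'n ^ 'n" and u :: "'n \<Rightarrow> real ^ 'n" and p :: nat and K :: real
  assumes "transpose A = A" and "transpose E = E" and "E \<noteq> 0"
    and "1 \<le> p" and "p \<le> CARD('n) - 1"
    and "orthonormal_eigenbasis A u"
    and "K > 0"
    and "eigen_gap A p \<ge>
      90 * ln (3 + spectral_norm A /
                 sqrt (real (eigen_count A E p K) * max_interaction u E * spectral_norm E))
         * max (spectral_norm E / K)
               (sqrt (real (eigen_count A E p K) * max_interaction u E * spectral_norm E))"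
  shows "eigval (A + E) p \<ge> eigval A p -
      45 * ln (3 + spectral_norm A /
                 sqrt (real (eigen_count A E p K) * max_interaction u E * spectral_norm E))
         * max (spectral_norm E / K)
               (sqrt (real (eigen_count A E p K) * max_interaction u E * spectral_norm E))"
proof -
  let ?s = "sqrt (real (eigen_count A E p K) * max_interaction u E * spectral_norm E)"
  let ?L = "ln (3 + spectral_norm A / ?s)" and ?M = "max (spectral_norm E / K) ?s"
  have p: "1 \<le> p" "p \<le> CARD('n)" using assms(4,5) by auto
  obtain \<mu> where on: "\<And>i j. u i \<bullet> u j = (if i = j then 1 else 0)"
    and eig: "\<And>i. A *v u i = \<mu> i *\<^sub>R u i"
    using assms(6) unfolding orthonormal_eigenbasis_def by metis
  have e0: "0 \<le> spectral_norm E" by (rule spectral_norm_nonneg)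
  have "0 \<le> max_interaction u E"
    by (rule order_trans[OF abs_ge_zero max_interaction_bound])
  then have s0: "0 \<le> ?s" using e0 by simp
  \<comment> \<open>The bound on the logarithm also covers \<open>?s = 0\<close>, where the quotient
    is 0 by convention and \<open>?L\<close> is \<open>ln 3\<close>.\<close>
  have "exp 1 \<le> (3::real)" by (rule exp_le)
  also have "\<dots> \<le> 3 + spectral_norm A / ?s"
    using spectral_norm_nonneg[of A] s0 by simp
  finally have L1: "1 \<le> ?L"
    using ln_ge_iff s0 spectral_norm_nonneg[of A]
    by (metis exp_gt_zero order_less_le_trans)
  have M0: "0 \<le> ?M" using s0 by (rule max.coboundedI2)
  \<comment> \<open>The assumed lower bound on the gap is nonnegative. Hence the counting threshold
    does not exceed \<open>eigval A p\<close>, and at least \<open>p\<close> eigenvalues are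
    counted.\<close>
  have "0 \<le> eigen_gap A p"
    using assms(8) L1 M0 by (smt (verit) mult_nonneg_nonneg)
  moreover have "0 \<le> K * spectral_norm E" using e0 \<open>K > 0\<close> by simp
  ultimately have "eigval A p - eigen_gap A p / 2 - K * spectral_norm E \<le> eigval A p"
    by linarith
  then have "p \<le> eigen_count A E p K"
    unfolding eigen_count_def length_filter_eigenvalues[OF on eig] le_eigval_iff[OF on eig p] .
  then have "eigval A p - ?s \<le> eigval (A + E) p"
    by (rule eigval_perturbation[OF assms(1,2) p assms(6)])
  moreover have "?s \<le> 45 * ?L * ?M"
  proof -
    \<comment> \<open>The factor \<open>45 * ?L\<close> is at least 1, and \<open>?s\<close> is one
      of the two terms of the maximum \<open>?M\<close>.\<close>
    have "1 * ?s \<le> (45 * ?L) * ?M"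
      using L1 s0 M0 by (intro mult_mono) auto
    then show ?thesis by simp
  qed
  ultimately show ?thesis by linarith
qed

end
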